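(* Let $\kappa>1$. For every $\epsilon>0$, the largest positive integer $N_\epsilon$ that is $\kappa$-colossally abundant for $\epsilon$ satisfies \[ N_\epsilon=\prod_{p\ \text{prime}}p^{\alpha_p(\epsilon)},\qquad \alpha_p(\epsilon):=\lfloor a_p(\epsilon)\rfloor . \] Moreover, if $\epsilon$ is not a $\kappa$-critical value, then $N_\epsilon$ is the only positive integer that is $\kappa$-colossally abundant for $\epsilon$.
   Context: For real $\kappa>0$ and a positive integer $n$, $\sigma^{[\kappa]}(n):=\sum_{d\mid n}\mu(n/d)\sigma(d)^{\kappa}$ ($\sigma$ the sum-of-divisors function, $\mu$ the Möbius function). For $\epsilon>0$, a positive integer $N$ is $\kappa$-colossally abundant for $\epsilon$ if $\sigma^{[\kappa]}(N)/N^{\kappa(1+\epsilon)}\ge\sigma^{[\kappa]}(n)/n^{\kappa(1+\epsilon)}$ for all positive integers $n$. For $x>1$, $a\ge1$, \[ F^{[\kappa]}(x,a):=\frac{1}{\kappa\log x}\log\left(\frac{(x^{a+1}-1)^{\kappa}-(x^{a}-1)^{\kappa}}{(x^{a+1}-x)^{\kappa}-(x^{a}-x)^{\kappa}}\right); \] for fixed $x>1$, $a\mapsto F^{[\kappa]}(x,a)$ is a strictly decreasing bijection from $[1,\infty)$ onto $(0,F^{[\kappa]}(x,1)]$, and for a prime $p$ and $0<\epsilon\le F^{[\kappa]}(p,1)$, $a_p(\epsilon)$ denotes the unique $a\ge1$ with $F^{[\kappa]}(p,a)=\epsilon$; for $\epsilon>F^{[\kappa]}(p,1)$ one takes $\alpha_p(\epsilon)=0$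 (convention $F^{[\kappa]}(p,0)=\infty$). A real $\epsilon>0$ is a $\kappa$-critical value if $\epsilon=F^{[\kappa]}(p,j)$ for some prime $p$ and positive integer $j$. *)

theory Defs
  imports "HOL-Analysis.Analysis" "HOL-Computational_Algebra.Computational_Algebra"
    "HOL-Number_Theory.Number_Theory"
begin

definition moebius_mu :: "nat \<Rightarrow> int" where
  "moebius_mu n = (if squarefree n then (- 1) ^ card (prime_factors n) else 0)"

definition divisor_sum :: "nat \<Rightarrow> nat" where
  "divisor_sum n = (\<Sum>d | d dvd n. d)"

definition sigma_kappa :: "real \<Rightarrow> nat \<Rightarrow> real" where
  "sigma_kappa \<kappa> n =
     (\<Sum>d | d dvd n. of_int (moebius_mu (n div d)) * real (divisor_sum d) powr \<kappa>)"

definition colossally_abundant :: "real \<Rightarrow> real \<Rightarrow> nat \<Rightarrow> bool" where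
  "colossally_abundant \<kappa> \<epsilon> N \<longleftrightarrow>
     N > 0 \<and>
     (\<forall>n>0. sigma_kappa \<kappa> N / real N powr (\<kappa> * (1 + \<epsilon>))
           \<ge> sigma_kappa \<kappa> n / real n powr (\<kappa> * (1 + \<epsilon>)))"

text \<open>Meant for \<open>x > 1\<close> and \<open>a \<ge> 1\<close>. At \<open>a = 1\<close> the subtrahend in the
  denominator is \<open>0 powr \<kappa>\<close>, which is \<open>0\<close>.\<close>

definition F_kappa :: "real \<Rightarrow> real \<Rightarrow> real \<Rightarrow> real" where
  "F_kappa \<kappa> x a =
     1 / (\<kappa> * ln x) *
     ln (((x powr (a + 1) - 1) powr \<kappa> - (x powr a - 1) powr \<kappa>) /
         ((x powr (a + 1) - x) powr \<kappa> - (x powr a - x) powr \<kappa>))"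

text \<open>For \<open>\<kappa> > 1\<close> and fixed \<open>x > 1\<close> the function \<open>F_kappa \<kappa> x\<close> is a strictly decreasing bijection from
  \<open>{1..}\<close> onto \<open>{0<..F_kappa \<kappa> x 1}\<close>, so the description below is proper exactly in the
  first case of \<open>alpha_exp\<close>.\<close>

definition a_exp :: "real \<Rightarrow> nat \<Rightarrow> real \<Rightarrow> real" where
  "a_exp \<kappa> p \<epsilon> = (THE a. a \<ge> 1 \<and> F_kappa \<kappa> (real p) a = \<epsilon>)"

definition alpha_exp :: "real \<Rightarrow> nat \<Rightarrow> real \<Rightarrow> nat" where
  "alpha_exp \<kappa> p \<epsilon> =
     (if \<epsilon> \<le> F_kappa \<kappa> (real p) 1 then nat \<lfloor>a_exp \<kappa> p \<epsilon>\<rfloor> else 0)"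

definition critical_value :: "real \<Rightarrow> real \<Rightarrow> bool" where
  "critical_value \<kappa> \<epsilon> \<longleftrightarrow>
     \<epsilon> > 0 \<and> (\<exists>p j::nat. prime p \<and> j > 0 \<and> \<epsilon> = F_kappa \<kappa> (real p) (real j))"

end

theory Submission
  imports Defs
begin

text \<open>
  The quotient \<open>f n = sigma_kappa \<kappa> n / n powr (\<kappa> * (1 + \<epsilon>))\<close> is multiplicative, so it is maximized one prime at
  a time. The definition of \<open>F\<close> is arranged so that
  \<open>f (p ^ k) / f (p ^ (k - 1)) = p powr (\<kappa> * (F p k - \<epsilon>))\<close>; as \<open>F p\<close> is strictly decreasing,
  \<open>k \<mapsto> f (p ^ k)\<close> rises weakly up to \<open>k = \<lfloor>a\<^sub>p\<rfloor>\<close>, strictly unless \<open>\<epsilon>\<close> is critical, and falls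
  strictly afterwards.

  For the monotonicity of \<open>F\<close>, put \<open>u = x powr - a\<close> and \<open>N u = (x - u) powr \<kappa> - (1 - u) powr \<kappa>\<close>. Then
  \<open>\<kappa> * ln x * F x a = ln (N u) - ln (N (x * u))\<close>, so it suffices that \<open>ln (N u)\<close> is strictly concave
  as a function of \<open>ln u\<close>.
\<close>

section \<open>Multiplicativity of the arithmetic functions\<close>

text \<open>Divisors of \<open>m * n\<close> correspond to pairs of divisors by multiplication, with
  inverse \<open>d \<mapsto> (gcd d m, gcd d n)\<close>. The two factors \<open>u\<close> and
  \<open>v\<close> may differ from \<open>g\<close>, because in \<open>sigma_kappa\<close> the
  summand depends on the number itself through the quotient \<open>n div d\<close>.\<close>

lemma sum_divisors_mult_coprime:
  fixes m n :: nat and g :: "nat \<Rightarrow> 'a::comm_semiring_0"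
  assumes "coprime m n" "m > 0" "n > 0"
    and g: "\<And>a b. a dvd m \<Longrightarrow> b dvd n \<Longrightarrow> g (a * b) = u a * v b"
  shows "(\<Sum>d | d dvd m * n. g d) = (\<Sum>d | d dvd m. u d) * (\<Sum>d | d dvd n. v d)"
proof -
  have gcd_left: "gcd (a * b) m = a" if "a dvd m" "b dvd n" for a b
  proof -
    have "coprime m b"
      using coprime_divisors[OF dvd_refl that(2) assms(1)] .
    then show ?thesis
      using that(1) by (simp add: gcd_mult_left_right_cancel gcd_nat.absorb1)
  qed
  have gcd_right: "gcd (a * b) n = b" if "a dvd m" "b dvd n" for a b
  proof -
    have "coprime n a"
      using coprime_divisors[OF that(1) dvd_refl assms(1)] by (simp add: coprime_commute)
    then show ?thesis
      using that(2) by (simp add: gcd_mult_left_left_cancel gcd_nat.absorb1)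
  qed
  have split: "gcd d m * gcd d n = d" if d: "d dvd m * n" for d
  proof -
    obtain a b where "d = a * b" "a dvd m" "b dvd n"
      using division_decomp[OF d] by blast
    then show ?thesis by (simp add: gcd_left gcd_right)
  qed
  have "(\<Sum>(a, b) \<in> {d. d dvd m} \<times> {d. d dvd n}. g (a * b)) = (\<Sum>d | d dvd m * n. g d)"
    by (rule sum.reindex_bij_witness[where j = "\<lambda>(a, b). a * b"
          and i = "\<lambda>d. (gcd d m, gcd d n)"])
       (auto simp: gcd_left gcd_right split intro: mult_dvd_mono)
  moreover have "(\<Sum>(a, b) \<in> {d. d dvd m} \<times> {d. d dvd n}. g (a * b)) =
      (\<Sum>(a, b) \<in> {d. d dvd m} \<times> {d. d dvd n}. u a * v b)"
    by (intro sum.cong) (auto simp: g)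
  ultimately have "(\<Sum>d | d dvd m * n. g d) =
      (\<Sum>(a, b) \<in> {d. d dvd m} \<times> {d. d dvd n}. u a * v b)"
    by simp
  then show ?thesis
    by (simp add: sum_product sum.cartesian_product)
qed

lemma divisor_sum_mult_coprime:
  assumes "coprime m n" "m > 0" "n > 0"
  shows "divisor_sum (m * n) = divisor_sum m * divisor_sum n"
  unfolding divisor_sum_def using assms by (intro sum_divisors_mult_coprime) auto

lemma moebius_mu_mult_coprime:
  assumes "coprime m n" "m > 0" "n > 0"
  shows "moebius_mu (m * n) = moebius_mu m * moebius_mu n"
proof (cases "squarefree m \<and> squarefree n")
  case True
  have "prime_factors m \<inter> prime_factors n = {}"
  proof -
    have False if "p \<in> prime_factors m" "p \<in> prime_factors n" for p
    proof -
      have "p dvd m" "p dvd n" "prime p"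
        using that by (auto simp: in_prime_factors_iff)
      then show False
        using coprime_common_divisor[OF assms(1)] not_prime_unit by blast
    qed
    then show ?thesis by blast
  qed
  then have "card (prime_factors (m * n)) = card (prime_factors m) + card (prime_factors n)"
    using assms by (simp add: prime_factors_product card_Un_disjoint)
  then show ?thesis
    using True assms by (simp add: moebius_mu_def squarefree_mult_coprime power_add)
next
  case False
  then show ?thesis
    by (auto simp: moebius_mu_def dest: squarefree_multD)
qed

lemma moebius_mu_prime_power:
  assumes "prime p"
  shows "moebius_mu (p ^ k) = (if k = 0 then 1 else if k = 1 then - 1 else 0)"
  using assms
  by (auto simp: moebius_mu_def squarefree_power_iff squarefree_prime prime_factorization_prime
      dest: prime_gt_1_nat)

lemma sigma_kappa_mult_coprime:
  assumes "coprime m n" "m > 0" "n > 0"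
  shows "sigma_kappa \<kappa> (m * n) = sigma_kappa \<kappa> m * sigma_kappa \<kappa> n"
  unfolding sigma_kappa_def
proof (rule sum_divisors_mult_coprime[OF assms])
  fix a b assume ab: "a dvd m" "b dvd n"
  then obtain c d where cd: "m = a * c" "n = b * d"
    by (auto elim!: dvdE)
  have pos: "a > 0" "b > 0" "c > 0" "d > 0"
    using assms(2,3) cd by auto
  have quot: "m div a = c" "n div b = d" "m * n div (a * b) = c * d"
    using ab pos by (simp_all add: cd div_mult_div_if_dvd[symmetric] mult.assoc mult.left_commute)
  have "coprime a b" "coprime c d"
    using assms(1) by (auto simp: cd)
  then show "of_int (moebius_mu (m * n div (a * b))) * real (divisor_sum (a * b)) powr \<kappa> =
      (of_int (moebius_mu (m div a)) * real (divisor_sum a) powr \<kappa>) *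
      (of_int (moebius_mu (n div b)) * real (divisor_sum b) powr \<kappa>)"
    using pos by (simp add: quot moebius_mu_mult_coprime divisor_sum_mult_coprime powr_mult)
qed

section \<open>Values at prime powers\<close>

lemma sum_divisors_prime_power:
  fixes p :: nat
  assumes "prime p"
  shows "(\<Sum>d | d dvd p ^ k. g d) = (\<Sum>i\<le>k. g (p ^ i))"
proof -
  have "{d. d dvd p ^ k} = (\<lambda>i. p ^ i) ` {..k}"
    using divides_primepow_nat[OF assms] by auto
  moreover have "inj_on (\<lambda>i. p ^ i) {..k}"
    using prime_gt_1_nat[OF assms] by (auto intro!: inj_onI)
  ultimately show ?thesis
    by (simp add: sum.reindex)
qed

lemma divisor_sum_prime_power:
  assumes "prime p"
  shows "real (divisor_sum (p ^ k)) = (real p ^ Suc k - 1) / (real p - 1)"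
proof -
  have "real (divisor_sum (p ^ k)) = (\<Sum>i\<le>k. real p ^ i)"
    by (simp add: divisor_sum_def sum_divisors_prime_power[OF assms])
  also have "\<dots> = (\<Sum>i<Suc k. real p ^ i)"
    by (simp add: lessThan_Suc_atMost)
  also have "\<dots> = (real p ^ Suc k - 1) / (real p - 1)"
    using prime_gt_1_nat[OF assms] by (intro geometric_sum) auto
  finally show ?thesis .
qed

text \<open>The Mobius factor leaves only the divisors \<open>p ^ k\<close> and
  \<open>p ^ (k - 1)\<close>. At \<open>k = 0\<close> there is no second divisor, which agrees with
  the formula since its second term is \<open>0 powr \<kappa> = 0\<close>.\<close>

lemma sigma_kappa_prime_power:
  assumes "prime p"
  shows "sigma_kappa \<kappa> (p ^ k) =
    ((real p ^ Suc k - 1) powr \<kappa> - (real p ^ k - 1) powr \<kappa>) / (real p - 1) powr \<kappa>"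
proof -
  have p: "p > 1" using prime_gt_1_nat[OF assms] .
  let ?s = "\<lambda>i. real (divisor_sum (p ^ i)) powr \<kappa>"
  have *: "?s i = (real p ^ Suc i - 1) powr \<kappa> / (real p - 1) powr \<kappa>" for i
    by (simp add: divisor_sum_prime_power[OF assms] powr_divide)
  have "sigma_kappa \<kappa> (p ^ k) = (\<Sum>i\<le>k. of_int (moebius_mu (p ^ k div p ^ i)) * ?s i)"
    by (simp add: sigma_kappa_def sum_divisors_prime_power[OF assms])
  also have "\<dots> = (\<Sum>i\<le>k. of_int (moebius_mu (p ^ (k - i))) * ?s i)"
    using p by (intro sum.cong) (auto simp: power_diff)
  also have "\<dots> = ((real p ^ Suc k - 1) powr \<kappa> - (real p ^ k - 1) powr \<kappa>) / (real p - 1) powr \<kappa>"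
  proof (cases k)
    case 0
    then show ?thesis
      using moebius_mu_prime_power[OF assms, of 0] *[of 0] p by simp
  next
    case (Suc j)
    have "(\<Sum>i\<le>k. of_int (moebius_mu (p ^ (k - i))) * ?s i) =
        (\<Sum>i\<in>{j, k}. of_int (moebius_mu (p ^ (k - i))) * ?s i)"
      using Suc by (intro sum.mono_neutral_right) (auto simp: moebius_mu_prime_power[OF assms])
    then show ?thesis
      using Suc by (simp add: moebius_mu_prime_power[OF assms] * diff_divide_distrib)
  qed
  finally show ?thesis .
qed

section \<open>Maximizing a multiplicative function prime by prime\<close>

lemma multiplicative_prod_prime_powers:
  fixes f :: "nat \<Rightarrow> 'a::comm_monoid_mult"
  assumes "\<And>m n. coprime m n \<Longrightarrow> m > 0 \<Longrightarrow> n > 0 \<Longrightarrow> f (m * n) = f m * f n" "f 1 = 1"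
    and "finite S" "\<And>p. p \<in> S \<Longrightarrow> prime p"
  shows "f (\<Prod>p\<in>S. p ^ e p) = (\<Prod>p\<in>S. f (p ^ e p))"
  using assms(3,4)
proof (induction S rule: finite_induct)
  case empty
  then show ?case using assms(2) by simp
next
  case (insert q S)
  have "coprime (q ^ e q) (\<Prod>p\<in>S. p ^ e p)"
    using insert by (intro prod_coprime_right) (metis coprime_power_left_iff coprime_power_right_iff
        insertCI primes_coprime)
  moreover have "q ^ e q > 0" "(\<Prod>p\<in>S. p ^ e p) > 0"
    using insert.prems by (auto intro!: prod_pos simp: prime_gt_0_nat)
  ultimately show ?case
    using insert assms(1) by simp
qed

lemma prod_prime_powers_multiplicity:
  fixes n :: nat
  assumes "n > 0" "finite S" "\<And>p. p \<in> S \<Longrightarrow> prime p" "prime_factors n \<subseteq> S"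
  shows "(\<Prod>p\<in>S. p ^ multiplicity p n) = n"
proof -
  have "(\<Prod>p\<in>S. p ^ multiplicity p n) = (\<Prod>p\<in>prime_factors n. p ^ multiplicity p n)"
    using assms by (intro prod.mono_neutral_right) (auto simp: prime_factors_multiplicity)
  then show ?thesis
    using assms(1) prime_factorization_nat by simp
qed

text \<open>Both values are products over one finite set of primes that contains \<open>A\<close>
  and the prime factors of \<open>n\<close>, so they can be compared factor by factor. As all
  factors are positive, a strict inequality at a single prime would survive in the product; hence
  equality of the products forces equality at every prime.\<close>

lemma multiplicative_le_prod_prime_powers:
  fixes f :: "nat \<Rightarrow> real" and e :: "nat \<Rightarrow> nat"
  defines "A \<equiv> {p. prime p \<and> e p \<noteq> 0}"
  assumes mult: "\<And>m n. coprime m n \<Longrightarrow> m > 0 \<Longrightarrow> n > 0 \<Longrightarrow> f (m * n) = f m * f n"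
    and one: "f 1 = 1"
    and pos: "\<And>p k. prime p \<Longrightarrow> f (p ^ k) > 0"
    and max: "\<And>p k. prime p \<Longrightarrow> f (p ^ k) \<le> f (p ^ e p)"
    and fin: "finite A" and n: "n > 0"
  shows "f n \<le> f (\<Prod>p\<in>A. p ^ e p)"
    and "f n = f (\<Prod>p\<in>A. p ^ e p) \<Longrightarrow> prime q \<Longrightarrow> f (q ^ multiplicity q n) = f (q ^ e q)"
proof -
  have fn: "f n = (\<Prod>p\<in>S. f (p ^ multiplicity p n))"
    and fe: "f (\<Prod>p\<in>A. p ^ e p) = (\<Prod>p\<in>S. f (p ^ e p))"
    if S: "finite S" "\<And>p. p \<in> S \<Longrightarrow> prime p" "A \<union> prime_factors n \<subseteq> S" for S
  proof -
    show "f n = (\<Prod>p\<in>S. f (p ^ multiplicity p n))"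
      using multiplicative_prod_prime_powers[of f S "\<lambda>p. multiplicity p n", OF mult one S(1,2)]
        prod_prime_powers_multiplicity[OF n S(1,2)] S(3) by simp
    have "(\<Prod>p\<in>A. p ^ e p) = (\<Prod>p\<in>S. p ^ e p)"
      using S by (intro prod.mono_neutral_left) (auto simp: A_def)
    then show "f (\<Prod>p\<in>A. p ^ e p) = (\<Prod>p\<in>S. f (p ^ e p))"
      using multiplicative_prod_prime_powers[of f S e, OF mult one S(1,2)] by simp
  qed
  define S where "S = A \<union> prime_factors n"
  have S: "finite S" "\<And>p. p \<in> S \<Longrightarrow> prime p"
    using fin by (auto simp: S_def A_def)
  show "f n \<le> f (\<Prod>p\<in>A. p ^ e p)"
  proof -
    have "(\<Prod>p\<in>S. f (p ^ multiplicity p n)) \<le> (\<Prod>p\<in>S. f (p ^ e p))"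
      using S(2) max pos by (intro prod_mono) (simp add: less_imp_le)
    then show ?thesis
      using fn[OF S] fe[OF S] by (simp add: S_def)
  qed
  assume eq: "f n = f (\<Prod>p\<in>A. p ^ e p)" and q: "prime q"
  \<comment> \<open>The prime \<open>q\<close> may lie outside \<open>S\<close>; adding it makes its
    factor visible in both products.\<close>
  define T where "T = insert q S"
  have T: "finite T" "\<And>p. p \<in> T \<Longrightarrow> prime p" "A \<union> prime_factors n \<subseteq> T"
    using S q by (auto simp: T_def S_def)
  have "\<not> f (q ^ multiplicity q n) < f (q ^ e q)"
  proof
    assume "f (q ^ multiplicity q n) < f (q ^ e q)"
    then have "(\<Prod>p\<in>T. f (p ^ multiplicity p n)) < (\<Prod>p\<in>T. f (p ^ e p))"
      using T(1,2) max pos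
      by (intro prod_mono_strict[of q]) (simp_all add: T_def less_imp_le)
    then show False
      using eq fn[OF T] fe[OF T] by simp
  qed
  then show "f (q ^ multiplicity q n) = f (q ^ e q)"
    using max[OF q] by (meson antisym_conv2)
qed

section \<open>Strict concavity of \<open>ln (powr_gap \<kappa> x u)\<close> in
  \<open>ln u\<close>\<close>

text \<open>This is the \<open>N u\<close> of the overview. The exponent is a parameter because
  differentiation in \<open>u\<close> leads to \<open>powr_gap (\<kappa> - 1)\<close>.\<close>

definition powr_gap :: "real \<Rightarrow> real \<Rightarrow> real \<Rightarrow> real" where
  "powr_gap \<kappa> x u = (x - u) powr \<kappa> - (1 - u) powr \<kappa>"

lemma powr_gap_pos:
  assumes "\<kappa> > 0" "x > 1" "u \<le> 1"
  shows "powr_gap \<kappa> x u > 0"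
  using assms by (simp add: powr_gap_def powr_less_mono2)

lemma continuous_on_powr_gap:
  assumes "\<kappa> > 0" "x > 1"
  shows "continuous_on {..1} (powr_gap \<kappa> x)"
  unfolding powr_gap_def using assms
  by (intro continuous_intros continuous_on_powr') auto

text \<open>In terms of \<open>R = r powr m\<close> and \<open>S = s powr m\<close>, both sides are
  reciprocals of slopes of chords of \<open>t \<mapsto> t powr (k / m)\<close> that end at
  \<open>t = 1\<close>. This function is convex since \<open>k / m \<ge> 1\<close>, so the slope
  grows with the left end point.\<close>

lemma one_minus_powr_ratio_antimono:
  fixes r s m k :: real
  assumes "0 < r" "r \<le> s" "s < 1" "0 < m" "m \<le> k"
  shows "(1 - s powr m) / (1 - s powr k) \<le> (1 - r powr m) / (1 - r powr k)"
proof -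
  have lt1: "t powr c < 1" if "0 < t" "t < 1" "c > 0" for t c :: real
    using that powr_less_mono2[of c t 1] by simp
  define R S where "R = r powr m" and "S = s powr m"
  have RS: "0 < R" "R \<le> S" "S < 1"
    using assms lt1 by (auto simp: R_def S_def powr_mono2)
  \<comment> \<open>The weight that writes \<open>S\<close> as a convex combination of
    \<open>1\<close> and \<open>R\<close>.\<close>
  define l where "l = (1 - S) / (1 - R)"
  have l: "0 \<le> l" "l \<le> 1" "l * (1 - R) = 1 - S" "S = (1 - l) * 1 + l * R"
    using RS by (auto simp: l_def divide_simps) (auto simp: algebra_simps)
  have "S powr (k / m) \<le> (1 - l) * 1 powr (k / m) + l * R powr (k / m)"
    using convex_onD[OF powr_convex[of "k / m"] l(1,2), of 1 R] RS assms l(4) by simp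
  then have "s powr k \<le> (1 - l) + l * r powr k"
    using assms by (simp add: R_def S_def powr_powr)
  then have "l * (1 - r powr k) \<le> 1 - s powr k"
    by (simp add: algebra_simps)
  then have "(1 - R) * (l * (1 - r powr k)) \<le> (1 - R) * (1 - s powr k)"
    using RS by (intro mult_left_mono) auto
  then have "(1 - S) * (1 - r powr k) \<le> (1 - R) * (1 - s powr k)"
    by (simp only: l(3)[symmetric] mult_ac)
  then show ?thesis
    using lt1[of r k] lt1[of s k] assms by (simp add: R_def S_def field_simps)
qed

text \<open>Up to the factor \<open>- \<kappa>\<close>, the quantity compared here is the derivative of \<open>ln (powr_gap \<kappa> x u)\<close> with
  respect to \<open>ln u\<close>.\<close>

lemma powr_gap_log_deriv_strict_mono:
  assumes "\<kappa> > 1" "x > 1" "0 < u" "u < v" "v < 1"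
  shows "u * powr_gap (\<kappa> - 1) x u / powr_gap \<kappa> x u < v * powr_gap (\<kappa> - 1) x v / powr_gap \<kappa> x v"
proof -
  \<comment> \<open>Taking powers of \<open>x - t\<close> out of both gaps turns the quantity into
    \<open>t / (x - t) * q t\<close>. The first factor increases strictly. As \<open>r\<close>
    decreases, \<open>q\<close> is nondecreasing by the chord-slope lemma with exponents
    \<open>\<kappa> - 1\<close> and \<open>\<kappa>\<close>; this is where
    \<open>\<kappa> > 1\<close> enters.\<close>
  define r where "r = (\<lambda>u. (1 - u) / (x - u))"
  define q where "q = (\<lambda>u. (1 - r u powr (\<kappa> - 1)) / (1 - r u powr \<kappa>))"
  have r: "0 < r t" "r t < 1" if "0 < t" "t < 1" for t
    using that assms by (auto simp: r_def)
  have eq: "t * powr_gap (\<kappa> - 1) x t / powr_gap \<kappa> x t = t / (x - t) * q t"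
    if "0 < t" "t < 1" for t
  proof -
    have pos: "x - t > 0" using that assms by simp
    have "powr_gap c x t = (x - t) powr c * (1 - r t powr c)" for c
      using pos by (simp add: powr_gap_def r_def powr_divide field_simps)
    moreover have "(x - t) powr \<kappa> = (x - t) * (x - t) powr (\<kappa> - 1)"
      using pos by (simp add: powr_mult_base)
    ultimately show ?thesis
      using pos by (simp add: q_def)
  qed
  have "r v \<le> r u"
  proof -
    have "(1 - v) * (x - u) \<le> (1 - u) * (x - v)"
      using mult_nonneg_nonneg[of "x - 1" "v - u"] assms by (simp add: algebra_simps)
    then show ?thesis
      using assms by (simp add: r_def divide_simps)
  qed
  then have "q u \<le> q v"
    using assms r[of u] r[of v] unfolding q_def by (intro one_minus_powr_ratio_antimono) auto
  moreover have "q u > 0"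
  proof -
    have "r u powr c < 1" if "c > 0" for c
      using that assms r[of u] powr_less_mono2[of c "r u" 1] by simp
    then show ?thesis using assms by (simp add: q_def)
  qed
  moreover have "u / (x - u) < v / (x - v)"
    using assms by (intro frac_less) auto
  moreover have "0 \<le> u / (x - u)" using assms by simp
  ultimately have "u / (x - u) * q u < v / (x - v) * q v"
    by (intro mult_less_le_imp_less) auto
  then show ?thesis using eq assms by simp
qed

section \<open>Monotonicity and range of \<open>F_kappa\<close>\<close>

text \<open>The substitution \<open>u = x powr - a\<close> carries \<open>a \<ge> 1\<close> to
  \<open>0 < u \<le> 1 / x\<close>, and the extra point \<open>u = 0\<close> stands for the limit of
  infinite \<open>a\<close>.\<close>

definition log_gap_ratio :: "real \<Rightarrow> real \<Rightarrow> real \<Rightarrow> real" where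
  "log_gap_ratio \<kappa> x u = ln (powr_gap \<kappa> x u) - ln (powr_gap \<kappa> x (x * u))"

lemma continuous_on_log_gap_ratio:
  assumes "\<kappa> > 0" "x > 1"
  shows "continuous_on {0..1 / x} (log_gap_ratio \<kappa> x)"
proof -
  have le: "u \<le> 1" "x * u \<le> 1" if "0 \<le> u" "u \<le> 1 / x" for u
  proof -
    show "x * u \<le> 1" using that assms by (simp add: field_simps)
    show "u \<le> 1" using that assms by (meson divide_le_eq_1_pos less_eq_real_def order_trans
      zero_less_one less_trans)
  qed
  have c: "continuous_on {0..1 / x} (\<lambda>u. powr_gap \<kappa> x (h u))"
    if "\<And>u. u \<in> {0..1 / x} \<Longrightarrow> h u \<le> 1" "continuous_on {0..1 / x} h" for h
    using that by (intro continuous_on_compose2[OF continuous_on_powr_gap[OF assms]]) auto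
  show ?thesis
    unfolding log_gap_ratio_def
    using le powr_gap_pos[OF assms]
    by (intro continuous_on_diff continuous_on_ln c continuous_intros ballI)
       (auto simp: less_imp_neq[symmetric] intro: less_imp_neq[symmetric])
qed

lemma powr_gap_has_field_derivative:
  assumes "x > 1" "u < 1"
  shows "(powr_gap \<kappa> x has_field_derivative - \<kappa> * powr_gap (\<kappa> - 1) x u) (at u)"
  unfolding powr_gap_def using assms
  by (auto intro!: derivative_eq_intros simp: algebra_simps)

text \<open>The derivative at \<open>t\<close> is \<open>\<kappa> / t * (M (x * t) - M t)\<close>,
  where \<open>M\<close> is the strictly increasing function of
  \<open>powr_gap_log_deriv_strict_mono\<close>, and \<open>x * t > t\<close>. Only continuity is
  used at the end points: the formula divides by \<open>t\<close>, and at \<open>t = 1 / x\<close>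
  the argument \<open>x * t\<close> reaches \<open>1\<close>, where differentiability is not
  claimed.\<close>

lemma log_gap_ratio_strict_mono:
  assumes "\<kappa> > 1" "x > 1" "0 \<le> u" "u < v" "v \<le> 1 / x"
  shows "log_gap_ratio \<kappa> x u < log_gap_ratio \<kappa> x v"
proof (rule DERIV_pos_imp_increasing_open[OF assms(4)])
  show "continuous_on {u..v} (log_gap_ratio \<kappa> x)"
    by (rule continuous_on_subset[OF continuous_on_log_gap_ratio]) (use assms in auto)
next
  fix t assume t: "u < t" "t < v"
  have "t < 1 / x" using t assms by linarith
  then have xt: "0 < t" "t < x * t" "x * t < 1"
    using t assms by (auto simp: field_simps)
  then have t1: "t < 1" by linarith
  define M where "M = (\<lambda>u. u * powr_gap (\<kappa> - 1) x u / powr_gap \<kappa> x u)"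
  have pos: "powr_gap \<kappa> x t > 0" "powr_gap \<kappa> x (x * t) > 0"
    using assms xt t1 by (auto intro!: powr_gap_pos)
  have "(powr_gap \<kappa> x has_field_derivative - \<kappa> * powr_gap (\<kappa> - 1) x t) (at t)"
    using assms t1 by (intro powr_gap_has_field_derivative) auto
  from DERIV_chain2[OF DERIV_ln[OF pos(1)] this]
  have 1: "((\<lambda>t. ln (powr_gap \<kappa> x t)) has_field_derivative
       inverse (powr_gap \<kappa> x t) * (- \<kappa> * powr_gap (\<kappa> - 1) x t)) (at t)" .
  have lin: "((\<lambda>t. x * t) has_field_derivative x) (at t)"
    by (auto intro!: derivative_eq_intros)
  have "(powr_gap \<kappa> x has_field_derivative - \<kappa> * powr_gap (\<kappa> - 1) x (x * t)) (at (x * t))"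
    using assms xt by (intro powr_gap_has_field_derivative) auto
  from DERIV_chain2[OF DERIV_ln[OF pos(2)] DERIV_chain2[OF this lin]]
  have 2: "((\<lambda>t. ln (powr_gap \<kappa> x (x * t))) has_field_derivative
       inverse (powr_gap \<kappa> x (x * t)) * (- \<kappa> * powr_gap (\<kappa> - 1) x (x * t) * x)) (at t)" .
  have "(log_gap_ratio \<kappa> x has_field_derivative \<kappa> / t * (M (x * t) - M t)) (at t)"
    unfolding log_gap_ratio_def
    by (rule DERIV_cong[OF DERIV_diff[OF 1 2]]) (use xt in \<open>simp add: M_def field_simps\<close>)
  moreover have "M t < M (x * t)"
    unfolding M_def using assms xt by (intro powr_gap_log_deriv_strict_mono) auto
  then have "\<kappa> / t * (M (x * t) - M t) > 0"
    using assms xt by simp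
  ultimately show "\<exists>y. (log_gap_ratio \<kappa> x has_real_derivative y) (at t) \<and> 0 < y"
    by blast
qed

lemma F_kappa_eq_log_gap_ratio:
  assumes "\<kappa> > 0" "x > 1" "a \<ge> 1"
  shows "F_kappa \<kappa> x a = log_gap_ratio \<kappa> x (x powr - a) / (\<kappa> * ln x)"
proof -
  define y u where "y = x powr a" and "u = x powr - a"
  have y: "y > 0" "y * u = 1" using assms by (auto simp: y_def u_def powr_minus field_simps)
  have "x powr (- a + 1) \<le> x powr 0"
    using assms by (intro powr_mono) auto
  then have "x powr (- a) * x powr 1 \<le> 1"
    using assms by (subst powr_add[symmetric]) simp
  then have "x * u \<le> 1" using assms by (simp add: u_def mult.commute)
  moreover have "u \<le> x * u" using assms by (simp add: u_def)
  ultimately have pos: "powr_gap \<kappa> x u > 0" "powr_gap \<kappa> x (x * u) > 0"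
    using assms powr_gap_pos by auto
  have xa: "x powr (a + 1) = y * x" using assms by (simp add: y_def powr_add)
  \<comment> \<open>Each of the four bases in \<open>F_kappa\<close> contains the factor
    \<open>y = x powr a\<close>, so \<open>y powr \<kappa>\<close> cancels in the quotient.\<close>
  have "y * x - 1 = y * (x - u)" "y - 1 = y * (1 - u)"
    "y * x - x = y * (x - x * u)" "y - x = y * (1 - x * u)"
    using y by (auto simp: algebra_simps)
  then have "(y * x - 1) powr \<kappa> - (y - 1) powr \<kappa> = y powr \<kappa> * powr_gap \<kappa> x u"
    "(y * x - x) powr \<kappa> - (y - x) powr \<kappa> = y powr \<kappa> * powr_gap \<kappa> x (x * u)"
    by (simp_all only: powr_gap_def powr_mult right_diff_distrib[of "y powr \<kappa>"])
  then have "F_kappa \<kappa> x a = 1 / (\<kappa> * ln x) *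
      ln ((y powr \<kappa> * powr_gap \<kappa> x u) / (y powr \<kappa> * powr_gap \<kappa> x (x * u)))"
    by (simp add: F_kappa_def xa y_def[symmetric])
  also have "\<dots> = log_gap_ratio \<kappa> x u / (\<kappa> * ln x)"
    using pos y by (simp add: ln_div log_gap_ratio_def)
  finally show ?thesis by (simp add: u_def)
qed

lemma F_kappa_strict_antimono:
  assumes "\<kappa> > 1" "x > 1" "1 \<le> a" "a < b"
  shows "F_kappa \<kappa> x b < F_kappa \<kappa> x a"
proof -
  have "x powr - b < x powr - a"
    using assms by (intro powr_less_mono) auto
  moreover have "x powr - a \<le> x powr - 1"
    using assms by (intro powr_mono) auto
  moreover have "x powr - 1 = 1 / x"
    using assms by (simp add: powr_minus field_simps)
  ultimately have "log_gap_ratio \<kappa> x (x powr - b) < log_gap_ratio \<kappa> x (x powr - a)"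
    using assms by (intro log_gap_ratio_strict_mono) auto
  then show ?thesis
    using assms by (simp add: F_kappa_eq_log_gap_ratio divide_strict_right_mono)
qed

lemma F_kappa_le_iff:
  assumes "\<kappa> > 1" "x > 1" "1 \<le> a" "1 \<le> b"
  shows "F_kappa \<kappa> x a \<le> F_kappa \<kappa> x b \<longleftrightarrow> b \<le> a"
  using F_kappa_strict_antimono[OF assms(1,2)] assms(3,4)
  by (metis less_eq_real_def linorder_not_less order_less_irrefl)

text \<open>The intermediate value theorem is applied to \<open>log_gap_ratio\<close> on the compact
  interval from \<open>0\<close> to \<open>1 / x\<close>. It vanishes at \<open>0\<close>, which
  replaces a limit computation for large \<open>a\<close>.\<close>

lemma F_kappa_surj:
  assumes "\<kappa> > 1" "x > 1" "0 < \<epsilon>" "\<epsilon> \<le> F_kappa \<kappa> x 1"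
  shows "\<exists>a\<ge>1. F_kappa \<kappa> x a = \<epsilon>"
proof -
  let ?G = "log_gap_ratio \<kappa> x"
  have c: "\<kappa> * ln x > 0" using assms by simp
  have G0: "?G 0 = 0" by (simp add: log_gap_ratio_def)
  have "?G (1 / x) / (\<kappa> * ln x) \<ge> \<epsilon>"
    using assms by (simp add: F_kappa_eq_log_gap_ratio powr_minus field_simps)
  then have "?G (1 / x) \<ge> \<epsilon> * (\<kappa> * ln x)"
    using c by (simp add: pos_le_divide_eq)
  moreover have pos: "\<epsilon> * (\<kappa> * ln x) > 0" using assms c by simp
  ultimately obtain u where u: "0 \<le> u" "u \<le> 1 / x" "?G u = \<epsilon> * (\<kappa> * ln x)"
    using IVT'[of ?G 0 "\<epsilon> * (\<kappa> * ln x)" "1 / x"] G0 continuous_on_log_gap_ratio[of \<kappa> x] assms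
    by auto
  \<comment> \<open>The target value is positive while \<open>?G 0 = 0\<close>; thus
    \<open>u\<close> comes from a finite \<open>a\<close>.\<close>
  have u0: "u > 0" using u pos G0 by (cases "u = 0") auto
  define a where "a = - log x u"
  have ua: "x powr - a = u" using u0 assms by (simp add: a_def)
  have "log x u \<le> log x (1 / x)" using u u0 assms by simp
  also have "\<dots> = - 1" using assms by (simp add: log_divide)
  finally have "a \<ge> 1" by (simp add: a_def)
  moreover have "F_kappa \<kappa> x a = \<epsilon>"
    using calculation assms u ua by (simp add: F_kappa_eq_log_gap_ratio)
  ultimately show ?thesis by blast
qed

section \<open>The exponents \<open>alpha_exp\<close> and their finite support\<close>

text \<open>Dropping the subtrahend of the numerator leaves the quotient \<open>((x - 1 / x) / (x -
  1)) powr \<kappa> = (1 + 1 / x) powr \<kappa>\<close>, and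
  \<open>ln (1 + 1 / x) \<le> 1 / x\<close>. The bound tends to 0 for large \<open>x\<close>, so
  only finitely many primes can have a nonzero exponent.\<close>

lemma F_kappa_1_le:
  assumes "\<kappa> > 1" "x > 1"
  shows "F_kappa \<kappa> x 1 \<le> 1 / (x * ln x)"
proof -
  have "powr_gap \<kappa> x (1 / x) \<le> (x - 1 / x) powr \<kappa>"
    by (simp add: powr_gap_def)
  moreover have "powr_gap \<kappa> x (1 / x) > 0" using assms by (intro powr_gap_pos) auto
  moreover have gt: "x - 1 / x > 0" using assms by (simp add: field_simps) (simp add: less_1_mult)
  ultimately have "ln (powr_gap \<kappa> x (1 / x)) \<le> \<kappa> * ln (x - 1 / x)"
    using ln_mono by (metis ln_powr)
  \<comment> \<open>At argument \<open>1\<close> the second term of the gap is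
    \<open>0 powr \<kappa> = 0\<close>.\<close>
  moreover have "ln (powr_gap \<kappa> x (x * (1 / x))) = \<kappa> * ln (x - 1)"
    using assms by (simp add: powr_gap_def ln_powr)
  ultimately have "log_gap_ratio \<kappa> x (1 / x) \<le> \<kappa> * (ln (x - 1 / x) - ln (x - 1))"
    by (simp add: log_gap_ratio_def algebra_simps)
  also have "ln (x - 1 / x) - ln (x - 1) = ln ((x - 1 / x) / (x - 1))"
    using assms gt by (simp add: ln_div)
  also have "(x - 1 / x) / (x - 1) = 1 + 1 / x"
    using assms by (simp add: field_simps)
  also have "ln (1 + 1 / x) \<le> 1 / x"
    using assms by (intro ln_add_one_self_le_self) auto
  finally have "log_gap_ratio \<kappa> x (1 / x) \<le> \<kappa> * (1 / x)" using assms by simp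
  moreover have "x powr - 1 = 1 / x" using assms by (simp add: powr_minus field_simps)
  ultimately show ?thesis
    using assms by (simp add: F_kappa_eq_log_gap_ratio field_simps)
qed

text \<open>This removes the description operator and the floor: for an integer \<open>j\<close>,
  \<open>j \<le> \<lfloor>a\<rfloor>\<close> means \<open>j \<le> a\<close>, and
  \<open>F_kappa\<close> reverses the order. If \<open>\<epsilon>\<close> exceeds the value at 1,
  both sides are false.\<close>

lemma alpha_exp_ge_iff:
  assumes "\<kappa> > 1" "\<epsilon> > 0" "p > 1" "j \<ge> 1"
  shows "j \<le> alpha_exp \<kappa> p \<epsilon> \<longleftrightarrow> \<epsilon> \<le> F_kappa \<kappa> (real p) (real j)"
proof (cases "\<epsilon> \<le> F_kappa \<kappa> (real p) 1")
  case True
  have p: "real p > 1" using assms by simp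
  obtain a where a: "a \<ge> 1" "F_kappa \<kappa> (real p) a = \<epsilon>"
    using F_kappa_surj[OF assms(1) p assms(2) True] by blast
  have "b = a" if "b \<ge> 1" "F_kappa \<kappa> (real p) b = \<epsilon>" for b
    using F_kappa_le_iff[OF assms(1) p, of a b] F_kappa_le_iff[OF assms(1) p, of b a] a that by simp
  then have "a_exp \<kappa> p \<epsilon> = a"
    unfolding a_exp_def using a by blast
  then have "alpha_exp \<kappa> p \<epsilon> = nat \<lfloor>a\<rfloor>"
    using True by (simp add: alpha_exp_def)
  then have "j \<le> alpha_exp \<kappa> p \<epsilon> \<longleftrightarrow> real j \<le> a"
    using a(1) by (simp add: le_nat_iff le_floor_iff)
  then show ?thesis
    using F_kappa_le_iff[OF assms(1) p, of a "real j"] a assms(4) by simp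
next
  case False
  have "F_kappa \<kappa> (real p) (real j) \<le> F_kappa \<kappa> (real p) 1"
    using F_kappa_le_iff[of \<kappa> "real p" "real j" 1] assms by simp
  then show ?thesis
    using False assms(4) by (simp add: alpha_exp_def)
qed

text \<open>A nonzero exponent gives
  \<open>\<epsilon> \<le> 1 / (p * ln p) \<le> 1 / (p * ln 2)\<close>, which bounds
  \<open>p\<close>. Finiteness matters for the product formula, since a product over an infinite
  index set is 1 by convention.\<close>

lemma finite_alpha_exp_nonzero:
  assumes "\<kappa> > 1" "\<epsilon> > 0"
  shows "finite {p. prime p \<and> alpha_exp \<kappa> p \<epsilon> \<noteq> 0}"
proof (rule finite_subset)
  show "{p. prime p \<and> alpha_exp \<kappa> p \<epsilon> \<noteq> 0} \<subseteq> {..nat \<lfloor>1 / (\<epsilon> * ln 2)\<rfloor>}"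
  proof
    fix p assume "p \<in> {p. prime p \<and> alpha_exp \<kappa> p \<epsilon> \<noteq> 0}"
    then have p: "p \<ge> 2" "\<epsilon> \<le> F_kappa \<kappa> (real p) 1"
      by (auto simp: prime_ge_2_nat alpha_exp_def split: if_splits)
    have "\<epsilon> \<le> 1 / (real p * ln (real p))"
      using p F_kappa_1_le[OF assms(1), of "real p"] by simp
    also have "\<dots> \<le> 1 / (real p * ln 2)"
      using p by (intro divide_left_mono mult_left_mono) auto
    finally have "real p \<le> 1 / (\<epsilon> * ln 2)"
      using p assms by (simp add: field_simps)
    then show "p \<in> {..nat \<lfloor>1 / (\<epsilon> * ln 2)\<rfloor>}"
      by (simp add: le_nat_floor)
  qed
qed simp

section \<open>The abundancy quotient along powers of a prime\<close>

definition abundancy :: "real \<Rightarrow> real \<Rightarrow> nat \<Rightarrow> real" where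
  "abundancy \<kappa> \<epsilon> n = sigma_kappa \<kappa> n / real n powr (\<kappa> * (1 + \<epsilon>))"

lemma abundancy_mult_coprime:
  assumes "coprime m n" "m > 0" "n > 0"
  shows "abundancy \<kappa> \<epsilon> (m * n) = abundancy \<kappa> \<epsilon> m * abundancy \<kappa> \<epsilon> n"
  using assms by (simp add: abundancy_def sigma_kappa_mult_coprime powr_mult)

lemma abundancy_prime_power:
  assumes "prime p"
  shows "abundancy \<kappa> \<epsilon> (p ^ k) =
    powr_gap \<kappa> (real p) (real p powr - real k) / ((real p - 1) powr \<kappa> * real p powr (\<kappa> * \<epsilon> * real k))"
proof -
  have p: "real p > 1" using prime_gt_1_nat[OF assms] by simp
  define y u where "y = real p ^ k" and "u = real p powr - real k"
  have y: "y > 0" "y * u = 1" using p by (auto simp: y_def u_def powr_minus powr_realpow)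
  have "real p ^ Suc k - 1 = y * (real p - u)" "real p ^ k - 1 = y * (1 - u)"
    using y by (auto simp: y_def[symmetric] algebra_simps)
  then have "(real p ^ Suc k - 1) powr \<kappa> - (real p ^ k - 1) powr \<kappa> = y powr \<kappa> * powr_gap \<kappa> (real p) u"
    by (simp only: powr_gap_def powr_mult right_diff_distrib[of "y powr \<kappa>"])
  moreover have "real (p ^ k) powr (\<kappa> * (1 + \<epsilon>)) = y powr \<kappa> * real p powr (\<kappa> * \<epsilon> * real k)"
  proof -
    have "y = real p powr real k" using p by (simp add: y_def powr_realpow)
    then show ?thesis
      by (simp add: powr_powr y_def[symmetric] powr_add[symmetric] algebra_simps)
  qed
  ultimately show ?thesis
    using y by (simp add: abundancy_def sigma_kappa_prime_power[OF assms] u_def)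
qed

lemma abundancy_prime_power_pos:
  assumes "\<kappa> > 0" "prime p"
  shows "abundancy \<kappa> \<epsilon> (p ^ k) > 0"
proof -
  have p: "real p > 1" using prime_gt_1_nat[OF assms(2)] by simp
  have "real p powr - real k \<le> real p powr 0" using p by (intro powr_mono) auto
  then show ?thesis
    using p powr_gap_pos[OF assms(1) p] by (simp add: abundancy_prime_power[OF assms(2)])
qed

text \<open>The sign of \<open>F_kappa\<close> minus \<open>\<epsilon>\<close> at
  \<open>Suc k\<close> thus decides whether passing from \<open>p ^ k\<close> to
  \<open>p ^ Suc k\<close> raises the quotient.\<close>

lemma ln_abundancy_prime_power_Suc:
  assumes "\<kappa> > 0" "prime p"
  shows "ln (abundancy \<kappa> \<epsilon> (p ^ Suc k)) - ln (abundancy \<kappa> \<epsilon> (p ^ k)) =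
    \<kappa> * ln (real p) * (F_kappa \<kappa> (real p) (real (Suc k)) - \<epsilon>)"
proof -
  have p: "real p > 1" using prime_gt_1_nat[OF assms(2)] by simp
  have ln_eq: "ln (abundancy \<kappa> \<epsilon> (p ^ i)) = ln (powr_gap \<kappa> (real p) (real p powr - real i))
      - \<kappa> * ln (real p - 1) - \<kappa> * \<epsilon> * real i * ln (real p)" for i
  proof -
    have "real p powr - real i \<le> real p powr 0" using p by (intro powr_mono) auto
    then have "powr_gap \<kappa> (real p) (real p powr - real i) > 0"
      using p powr_gap_pos[OF assms(1) p] by simp
    then show ?thesis
      using p by (simp add: abundancy_prime_power[OF assms(2)] ln_div ln_mult ln_powr)
  qed
  \<comment> \<open>With \<open>u = p powr - (k + 1)\<close>, the second argument
    \<open>p * u\<close> of \<open>log_gap_ratio\<close> is the \<open>u\<close> that belongs to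
    \<open>k\<close>. So the gaps of two consecutive powers are exactly those in
    \<open>F_kappa\<close> at \<open>Suc k\<close>.\<close>
  have "real p * real p powr - real (Suc k) = real p powr - real k"
    using p by (simp add: powr_mult_base)
  then have "\<kappa> * ln (real p) * F_kappa \<kappa> (real p) (real (Suc k)) =
      ln (powr_gap \<kappa> (real p) (real p powr - real (Suc k))) -
      ln (powr_gap \<kappa> (real p) (real p powr - real k))"
    using assms p F_kappa_eq_log_gap_ratio[of \<kappa> "real p" "real (Suc k)"]
    by (simp add: log_gap_ratio_def)
  then show ?thesis
    unfolding ln_eq by (simp add: algebra_simps)
qed

lemma abundancy_prime_power_Suc_iff:
  assumes "\<kappa> > 0" "prime p"
  shows "abundancy \<kappa> \<epsilon> (p ^ k) \<le> abundancy \<kappa> \<epsilon> (p ^ Suc k) \<longleftrightarrow>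
      \<epsilon> \<le> F_kappa \<kappa> (real p) (real (Suc k))" (is ?le)
    and "abundancy \<kappa> \<epsilon> (p ^ k) < abundancy \<kappa> \<epsilon> (p ^ Suc k) \<longleftrightarrow>
      \<epsilon> < F_kappa \<kappa> (real p) (real (Suc k))" (is ?less)
proof -
  let ?D = "F_kappa \<kappa> (real p) (real (Suc k)) - \<epsilon>"
  have pos: "abundancy \<kappa> \<epsilon> (p ^ i) > 0" for i
    using abundancy_prime_power_pos assms by blast
  have c: "\<kappa> * ln (real p) > 0"
    using assms prime_gt_1_nat[OF assms(2)] by simp
  note eq = ln_abundancy_prime_power_Suc[OF assms, of \<epsilon> k]
  have "0 \<le> \<kappa> * ln (real p) * ?D \<longleftrightarrow> 0 \<le> ?D" "0 < \<kappa> * ln (real p) * ?D \<longleftrightarrow> 0 < ?D"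
    using mult_le_cancel_left_pos[OF c, of 0 ?D] mult_less_cancel_left_pos[OF c, of 0 ?D]
    by (simp_all only: mult_zero_right)
  moreover have "abundancy \<kappa> \<epsilon> (p ^ k) \<le> abundancy \<kappa> \<epsilon> (p ^ Suc k) \<longleftrightarrow> 0 \<le> \<kappa> * ln (real p) * ?D"
    "abundancy \<kappa> \<epsilon> (p ^ k) < abundancy \<kappa> \<epsilon> (p ^ Suc k) \<longleftrightarrow> 0 < \<kappa> * ln (real p) * ?D"
    using ln_le_cancel_iff[OF pos[of k] pos[of "Suc k"]]
      ln_less_cancel_iff[OF pos[of k] pos[of "Suc k"]]
    unfolding eq[symmetric] by (simp_all only: diff_ge_0_iff_ge diff_gt_0_iff_gt)
  ultimately show ?le ?less by auto
qed

text \<open>In a linear order the failure of \<open>h j \<le> h (Suc j)\<close> is a strict descent.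
  The rise up to \<open>n\<close> is only weak, so ties with the peak can occur before
  \<open>n\<close> but not after it.\<close>

lemma unimodal_le_peak:
  fixes h :: "nat \<Rightarrow> 'a::linorder"
  assumes "\<And>j. h j \<le> h (Suc j) \<longleftrightarrow> j < n"
  shows "h k \<le> h n" "h k = h n \<Longrightarrow> k \<le> n"
proof -
  have up: "h k \<le> h n" if "k \<le> n"
    using that
  proof (induction rule: inc_induct)
    case (step j)
    then show ?case using assms[of j] by (meson order_trans)
  qed simp
  have down: "h k < h n" if "n < k"
  proof -
    have "h (n + Suc d) < h n" for d
    proof (induction d)
      case 0
      then show ?case using assms[of n] by simp
    next
      case (Suc d)
      then show ?case using assms[of "n + Suc d"] by (simp add: not_le)
    qed
    then show ?thesis using less_imp_Suc_add[OF that] by auto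
  qed
  show "h k \<le> h n" "h k = h n \<Longrightarrow> k \<le> n"
    using up down by (metis less_imp_le less_irrefl not_less)+
qed

text \<open>By \<open>alpha_exp_ge_iff\<close>, the steps that do not lower the quotient are exactly
  those starting below \<open>alpha_exp\<close>, which is therefore the peak.\<close>

lemma abundancy_prime_power_le_max:
  assumes "\<kappa> > 1" "\<epsilon> > 0" "prime p"
  shows "abundancy \<kappa> \<epsilon> (p ^ k) \<le> abundancy \<kappa> \<epsilon> (p ^ alpha_exp \<kappa> p \<epsilon>)"
    and "abundancy \<kappa> \<epsilon> (p ^ k) = abundancy \<kappa> \<epsilon> (p ^ alpha_exp \<kappa> p \<epsilon>) \<Longrightarrow> k \<le> alpha_exp \<kappa> p \<epsilon>"
    and "abundancy \<kappa> \<epsilon> (p ^ k) = abundancy \<kappa> \<epsilon> (p ^ alpha_exp \<kappa> p \<epsilon>) \<Longrightarrow>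
      \<not> critical_value \<kappa> \<epsilon> \<Longrightarrow> k = alpha_exp \<kappa> p \<epsilon>"
proof -
  define h where "h = (\<lambda>k. abundancy \<kappa> \<epsilon> (p ^ k))"
  define \<alpha> where "\<alpha> = alpha_exp \<kappa> p \<epsilon>"
  have \<alpha>: "j < \<alpha> \<longleftrightarrow> \<epsilon> \<le> F_kappa \<kappa> (real p) (real (Suc j))" for j
    using assms prime_gt_1_nat[OF assms(3)] alpha_exp_ge_iff[of \<kappa> \<epsilon> p "Suc j"]
    by (simp add: \<alpha>_def Suc_le_eq)
  have "\<kappa> > 0" using assms(1) by simp
  note iff = abundancy_prime_power_Suc_iff[OF this assms(3), of \<epsilon>, folded h_def]
  have step: "h j \<le> h (Suc j) \<longleftrightarrow> j < \<alpha>" for j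
    using iff(1) unfolding h_def \<alpha> .
  show "abundancy \<kappa> \<epsilon> (p ^ k) \<le> abundancy \<kappa> \<epsilon> (p ^ alpha_exp \<kappa> p \<epsilon>)"
    using unimodal_le_peak(1)[of h, OF step] by (simp add: h_def \<alpha>_def)
  assume eq: "abundancy \<kappa> \<epsilon> (p ^ k) = abundancy \<kappa> \<epsilon> (p ^ alpha_exp \<kappa> p \<epsilon>)"
  show k: "k \<le> alpha_exp \<kappa> p \<epsilon>"
    using unimodal_le_peak(2)[of h, OF step] eq by (simp add: h_def \<alpha>_def)
  assume crit: "\<not> critical_value \<kappa> \<epsilon>"
  show "k = alpha_exp \<kappa> p \<epsilon>"
  proof (rule ccontr)
    \<comment> \<open>A tie below the peak is excluded: without critical values the step from
      \<open>k\<close> to \<open>Suc k\<close> is strict, and the later steps do not fall below it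
      before \<open>\<alpha>\<close>.\<close>
    assume "k \<noteq> alpha_exp \<kappa> p \<epsilon>"
    then have lt: "k < \<alpha>" using k by (simp add: \<alpha>_def)
    moreover have "\<epsilon> \<noteq> F_kappa \<kappa> (real p) (real (Suc k))"
      using crit assms unfolding critical_value_def by blast
    ultimately have "h k < h (Suc k)"
      using iff(2)[of k] \<alpha>[of k] unfolding h_def by linarith
    also have "h (Suc k) \<le> h \<alpha>"
      using unimodal_le_peak(1)[of h, OF step] .
    finally show False
      using eq by (simp add: h_def \<alpha>_def)
  qed
qed

section \<open>The largest maximizer and its uniqueness\<close>

theorem theorem4p22:
  fixes \<kappa> \<epsilon> :: real
  assumes "\<kappa> > 1" and "\<epsilon> > 0"
  shows "\<exists>N. colossally_abundant \<kappa> \<epsilon> N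
           \<and> (\<forall>M. colossally_abundant \<kappa> \<epsilon> M \<longrightarrow> M \<le> N)
           \<and> finite {p. prime p \<and> alpha_exp \<kappa> p \<epsilon> \<noteq> 0}
           \<and> N = (\<Prod>p | prime p \<and> alpha_exp \<kappa> p \<epsilon> \<noteq> 0. p ^ alpha_exp \<kappa> p \<epsilon>)
           \<and> (\<not> critical_value \<kappa> \<epsilon> \<longrightarrow> (\<forall>M. colossally_abundant \<kappa> \<epsilon> M \<longrightarrow> M = N))"
proof -
  define A where "A = {p. prime p \<and> alpha_exp \<kappa> p \<epsilon> \<noteq> 0}"
  define N where "N = (\<Prod>p\<in>A. p ^ alpha_exp \<kappa> p \<epsilon>)"
  have fin: "finite A"
    using finite_alpha_exp_nonzero[OF assms] by (simp add: A_def)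
  have N: "N > 0"
    by (auto simp: N_def A_def prime_gt_0_nat intro!: prod_pos)
  have multN: "multiplicity p N = alpha_exp \<kappa> p \<epsilon>" if "prime p" for p
  proof -
    have "multiplicity p N = (if p \<in> A then alpha_exp \<kappa> p \<epsilon> else 0)"
      unfolding N_def using fin that
      by (intro multiplicity_prod_prime_powers) (auto simp: A_def)
    then show ?thesis
      using that by (simp add: A_def)
  qed
  have ca_iff: "colossally_abundant \<kappa> \<epsilon> M \<longleftrightarrow>
      M > 0 \<and> (\<forall>n>0. abundancy \<kappa> \<epsilon> n \<le> abundancy \<kappa> \<epsilon> M)" for M
    by (simp add: colossally_abundant_def abundancy_def)
  have one: "abundancy \<kappa> \<epsilon> 1 = 1"
    by (simp add: abundancy_def sigma_kappa_def divisor_sum_def moebius_mu_def)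
  have pos: "abundancy \<kappa> \<epsilon> (p ^ k) > 0" if "prime p" for p k
    using abundancy_prime_power_pos assms(1) that by simp
  note max_at = multiplicative_le_prod_prime_powers[of "abundancy \<kappa> \<epsilon>" "\<lambda>p. alpha_exp \<kappa> p \<epsilon>",
      OF abundancy_mult_coprime one pos abundancy_prime_power_le_max(1)[OF assms],
      folded A_def, OF _ _ _ _ _ fin, folded N_def]
  have caN: "colossally_abundant \<kappa> \<epsilon> N"
    using max_at(1) N by (simp add: ca_iff)
  \<comment> \<open>Two maximizers have the same quotient, so the equality case applies at every
    prime.\<close>
  have eq: "abundancy \<kappa> \<epsilon> (p ^ multiplicity p M) = abundancy \<kappa> \<epsilon> (p ^ alpha_exp \<kappa> p \<epsilon>)"
    if "colossally_abundant \<kappa> \<epsilon> M" "prime p" for M p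
  proof -
    have M: "M > 0" using that(1) unfolding ca_iff by blast
    moreover have "abundancy \<kappa> \<epsilon> M = abundancy \<kappa> \<epsilon> N"
      using that(1) caN N M unfolding ca_iff by (meson antisym)
    ultimately show ?thesis
      using max_at(2)[of M p] that(2) by blast
  qed
  \<comment> \<open>Every exponent of \<open>M\<close> attains the maximum at its prime and is thus
    at most \<open>alpha_exp\<close>. So \<open>M\<close> even divides \<open>N\<close>.\<close>
  have "M \<le> N" if M: "colossally_abundant \<kappa> \<epsilon> M" for M
  proof (rule dvd_imp_le[OF _ N], rule multiplicity_le_imp_dvd)
    show "M \<noteq> 0" using M by (simp add: ca_iff)
    show "multiplicity p M \<le> multiplicity p N" if "prime p" for p
      using abundancy_prime_power_le_max(2)[OF assms that eq[OF M that]] multN[OF that] by simp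
  qed
  moreover have "M = N" if M: "colossally_abundant \<kappa> \<epsilon> M" and "\<not> critical_value \<kappa> \<epsilon>" for M
  proof (rule multiplicity_eq_nat)
    show "M > 0" using M by (simp add: ca_iff)
    show "multiplicity p M = multiplicity p N" if "prime p" for p
      using abundancy_prime_power_le_max(3)[OF assms that eq[OF M that]] multN[OF that]
        \<open>\<not> critical_value \<kappa> \<epsilon>\<close> by simp
  qed (rule N)
  ultimately show ?thesis
    using caN fin by (auto simp: N_def A_def)
qed

end
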